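(* The degree-three dilation of the square lattice is $1+\sqrt{2}$; that is, $\mathrm{dil}_3(\mathbb{Z}^2) = 1+\sqrt{2}$, where $$\mathrm{dil}_3(\mathbb{Z}^2) = \inf_G \mathrm{dil}(G),$$ the infimum being taken over all plane geometric graphs $G$ on the point set $\mathbb{Z}^2\subset\mathbb{R}^2$ in which every vertex has degree at most $3$.
   Context: Let $P$ be a set of points in the Euclidean plane. A geometric graph $G$ on $P$ is an undirected graph with vertex set $P$ whose edges are drawn as straight line segments between their endpoints. It is plane if no two edges intersect except possibly at a common endpoint vertex. The length of a path is the sum of the Euclidean lengths of its edges, and $d_G(p,q)$ denotes the length of a shortest path from $p$ to $q$ using only edges of $G$ ($+\infty$ if there is no such path). For distinct $p,q\in P$ let $\mathrm{dil}_G(p,q) = d_G(p,q)/|pq|$, where $|pq|$ is the Euclidean distance, and let $\mathrm{dil}(G) = \sup_{p\neq q}\mathrm{dil}_G(p,q)$. *)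

theory Defs
  imports "HOL-Analysis.Analysis"
begin

text \<open>
  An undirected geometric graph on a point set \<open>P\<close> is given by its edge set \<open>E\<close>; an edge is the
  two-element set of its endpoints, and its drawing is the convex hull of that set
  (see \<open>segment_convex_hull\<close>).
\<close>

definition geometric_graph :: "(real^2) set \<Rightarrow> (real^2) set set \<Rightarrow> bool" where
  "geometric_graph P E \<longleftrightarrow> (\<forall>e\<in>E. e \<subseteq> P \<and> card e = 2)"

definition plane_drawing :: "(real^2) set set \<Rightarrow> bool" where
  "plane_drawing E \<longleftrightarrow>
     (\<forall>e\<in>E. \<forall>f\<in>E. e \<noteq> f \<longrightarrow> convex hull e \<inter> convex hull f \<subseteq> e \<inter> f)"

text \<open>Finiteness is explicit since \<open>card\<close> is 0 on infinite sets.\<close>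

definition max_degree_le :: "nat \<Rightarrow> (real^2) set \<Rightarrow> (real^2) set set \<Rightarrow> bool" where
  "max_degree_le k P E \<longleftrightarrow> (\<forall>p\<in>P. finite {e\<in>E. p \<in> e} \<and> card {e\<in>E. p \<in> e} \<le> k)"

definition graph_path :: "(real^2) set set \<Rightarrow> real^2 \<Rightarrow> (real^2) list \<Rightarrow> real^2 \<Rightarrow> bool" where
  "graph_path E p xs q \<longleftrightarrow>
     xs \<noteq> [] \<and> hd xs = p \<and> last xs = q \<and> distinct xs \<and> successively (\<lambda>x y. {x, y} \<in> E) xs"

definition path_len :: "(real^2) list \<Rightarrow> real" where
  "path_len xs = (\<Sum>i<length xs - 1. dist (xs ! i) (xs ! Suc i))"

text \<open>The infimum over the empty set of paths is \<open>\<infinity>\<close>.\<close>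

definition graph_dist :: "(real^2) set set \<Rightarrow> real^2 \<Rightarrow> real^2 \<Rightarrow> ereal" where
  "graph_dist E p q = (INF xs\<in>{xs. graph_path E p xs q}. ereal (path_len xs))"

definition dilation_between :: "(real^2) set set \<Rightarrow> real^2 \<Rightarrow> real^2 \<Rightarrow> ereal" where
  "dilation_between E p q = graph_dist E p q / ereal (dist p q)"

definition dilation :: "(real^2) set \<Rightarrow> (real^2) set set \<Rightarrow> ereal" where
  "dilation P E = (SUP (p, q)\<in>{(p, q). p \<in> P \<and> q \<in> P \<and> p \<noteq> q}. dilation_between E p q)"

definition degree_dilation :: "nat \<Rightarrow> (real^2) set \<Rightarrow> ereal" where
  "degree_dilation k P =
     (INF E\<in>{E. geometric_graph P E \<and> plane_drawing E \<and> max_degree_le k P E}. dilation P E)"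

definition square_lattice :: "(real^2) set" where
  "square_lattice = {x. \<forall>i. x $ i \<in> \<int>}"

end

(*
  Lower bound: the origin misses an edge to one of its four nearest neighbours. Any path replacing
  that edge has at least three edges, or two edges one of which has even nonzero squared length;
  either way its length is at least 1 + sqrt 2.

  Upper bound: in a suitable 3-regular subgraph of the triangulated grid, periodic under
  (2,1) and (8,0), some vectors g of the period lattice are joined by walks of length at most L(g)
  from every vertex. Put K = 1 + sqrt 2 and call (v, l) and (v', l') compatible if
  l l' <= K^2 <v, v'>. A sum of pairwise (and self-) compatible pairs has total length at most K times
  the norm of the total displacement. Six cones spanned by such vectors g cover a half-plane, and a
  displacement in one of them is a nonnegative integer combination of the two spanning vectors plus
  one of eight remainders, so finitely many compatibility checks suffice.
*)

theory Submission
  imports Defs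
begin

section \<open>Walks and graph distance\<close>

lemma path_len_singleton: "path_len [x] = 0"
  by (simp add: path_len_def)

lemma path_len_Cons: "path_len (x # y # zs) = dist x y + path_len (y # zs)"
  unfolding path_len_def by (simp add: sum.lessThan_Suc_shift del: sum.lessThan_Suc)

lemma path_len_nonneg: "0 \<le> path_len xs"
  unfolding path_len_def by (simp add: sum_nonneg)

lemma path_len_suffix_le: "path_len ys \<le> path_len (xs @ ys)"
proof (induction xs)
  case (Cons x xs)
  show ?case
  proof (cases "xs @ ys")
    case Nil
    then show ?thesis using path_len_nonneg by (simp add: path_len_def)
  next
    case (Cons z zs)
    then have "path_len ((x # xs) @ ys) = dist x z + path_len (xs @ ys)"
      by (simp add: path_len_Cons)
    then show ?thesis using Cons.IH by (smt (verit) zero_le_dist)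
  qed
qed simp

text \<open>Vertices may repeat and the bound may be slack, so these walks compose and reverse
  freely, whereas \<open>graph_path\<close> demands distinct vertices.\<close>

inductive reach :: "(real^2) set set \<Rightarrow> real^2 \<Rightarrow> real^2 \<Rightarrow> real \<Rightarrow> bool" for E where
  reach_refl: "0 \<le> l \<Longrightarrow> reach E p p l"
| reach_step: "{p, q} \<in> E \<Longrightarrow> reach E q r l \<Longrightarrow> dist p q + l \<le> m \<Longrightarrow> reach E p r m"

lemma reach_mono: "reach E p q l \<Longrightarrow> l \<le> m \<Longrightarrow> reach E p q m"
proof (induction arbitrary: m rule: reach.induct)
  case (reach_refl l p)
  then show ?case by (auto intro: reach.reach_refl)
next
  case (reach_step p q r l m')
  then have "dist p q + l \<le> m" by linarith
  then show ?case using reach_step by (blast intro: reach.reach_step)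
qed

lemma reach_trans: "reach E p q l \<Longrightarrow> reach E q r m \<Longrightarrow> reach E p r (l + m)"
proof (induction rule: reach.induct)
  case (reach_refl l p)
  then show ?case by (auto intro: reach_mono)
next
  case (reach_step p q r' l m')
  then have "reach E q r (l + m)" by blast
  then show ?case using reach_step by (auto intro: reach.reach_step)
qed

lemma reach_sym: "reach E p q l \<Longrightarrow> reach E q p l"
proof (induction rule: reach.induct)
  case (reach_refl l p)
  then show ?case by (auto intro: reach.reach_refl)
next
  case (reach_step p q r l m)
  have "reach E q p (dist p q)"
    using reach_step(1)
    by (intro reach.reach_step[OF _ reach.reach_refl[of 0]]) (auto simp: insert_commute dist_commute)
  from reach_trans[OF reach_step.IH this] show ?case
    using reach_step by (auto intro: reach_mono)
qed

text \<open>Loops are cut out: when the new first vertex already lies on the path, only the suffix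
  starting there is kept, and it is no longer than the path.\<close>

lemma reach_imp_path:
  assumes "reach E p q l"
  shows "\<exists>xs. graph_path E p xs q \<and> path_len xs \<le> l"
  using assms
proof (induction rule: reach.induct)
  case (reach_refl l p)
  then show ?case by (intro exI[of _ "[p]"]) (simp add: graph_path_def path_len_singleton)
next
  case (reach_step p q r l m)
  then obtain xs where xs: "graph_path E q xs r" "path_len xs \<le> l" by blast
  then obtain zs where zs: "xs = q # zs" unfolding graph_path_def by (cases xs) auto
  show ?case
  proof (cases "p \<in> set xs")
    case True
    then obtain us vs where uv: "xs = us @ p # vs" by (meson split_list)
    have "graph_path E p (p # vs) r"
      using xs(1) unfolding graph_path_def uv by (auto simp: successively_append_iff)
    moreover have "path_len (p # vs) \<le> m"
      using path_len_suffix_le[of "p # vs" us] xs(2) reach_step(3) zero_le_dist[of p q]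
      unfolding uv by linarith
    ultimately show ?thesis by blast
  next
    case False
    then have "graph_path E p (p # xs) r"
      using xs(1) reach_step(1) unfolding graph_path_def zs by auto
    moreover have "path_len (p # xs) \<le> m"
      using xs(2) reach_step(3) unfolding zs path_len_Cons by linarith
    ultimately show ?thesis by blast
  qed
qed

lemma graph_dist_le_reach:
  assumes "reach E p q l"
  shows "graph_dist E p q \<le> ereal l"
proof -
  obtain xs where "graph_path E p xs q" "path_len xs \<le> l"
    using reach_imp_path[OF assms] by blast
  then show ?thesis
    unfolding graph_dist_def by (intro INF_lower2[of xs]) auto
qed

section \<open>Integer points\<close>

definition pt :: "int \<Rightarrow> int \<Rightarrow> real^2" where
  "pt x y = vector [of_int x, of_int y]"

lemma pt_nth [simp]: "pt x y $ 1 = of_int x" "pt x y $ 2 = of_int y"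
  by (simp_all add: pt_def)

lemma pt_eq_iff [simp]: "pt x y = pt x' y' \<longleftrightarrow> x = x' \<and> y = y'"
  by (auto simp: vec_eq_iff forall_2)

lemma square_lattice_eq: "square_lattice = {pt x y | x y. True}"
proof (intro equalityI subsetI)
  fix p :: "real^2" assume "p \<in> square_lattice"
  then have "p $ 1 \<in> \<int>" "p $ 2 \<in> \<int>" unfolding square_lattice_def by auto
  then obtain x y where "p $ 1 = of_int x" "p $ 2 = of_int y"
    by (metis Ints_cases)
  then have "p = pt x y" by (simp add: vec_eq_iff forall_2)
  then show "p \<in> {pt x y | x y. True}" by blast
qed (auto simp: square_lattice_def forall_2)

lemma dist_pt: "dist (pt x y) (pt x' y') = sqrt (of_int ((x' - x)\<^sup>2 + (y' - y)\<^sup>2))"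
  by (simp add: dist_vec_def L2_set_def UNIV_2 dist_real_def power2_commute)

section \<open>The lower bound\<close>

lemma dist_lattice_ge_1:
  assumes "p \<in> square_lattice" "q \<in> square_lattice" "p \<noteq> q"
  shows "1 \<le> dist p q"
proof -
  obtain x y x' y' where pq: "p = pt x y" "q = pt x' y'"
    using assms by (auto simp: square_lattice_eq)
  have "(x' - x)\<^sup>2 + (y' - y)\<^sup>2 \<noteq> 0" using assms(3) by (auto simp: pq sum_power2_eq_zero_iff)
  then have "1 \<le> (x' - x)\<^sup>2 + (y' - y)\<^sup>2"
    by (smt (verit) zero_le_power2)
  then have "(1::real) \<le> of_int ((x' - x)\<^sup>2 + (y' - y)\<^sup>2)" by linarith
  then show ?thesis by (simp add: pq dist_pt)
qed

text \<open>The squared lengths of the two legs have odd sum, so one of them is at least 2.\<close>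

lemma two_leg_detour:
  assumes "p \<in> square_lattice" "q \<in> square_lattice" "r \<in> square_lattice"
    and "p \<noteq> r" "r \<noteq> q" "dist p q = 1"
  shows "1 + sqrt 2 \<le> dist p r + dist r q"
proof -
  obtain x y x' y' u v where pt: "p = pt x y" "q = pt x' y'" "r = pt u v"
    using assms by (auto simp: square_lattice_eq)
  define m n where "m = (u - x)\<^sup>2 + (v - y)\<^sup>2" and "n = (x' - u)\<^sup>2 + (y' - v)\<^sup>2"
  have d: "dist p r = sqrt (of_int m)" "dist r q = sqrt (of_int n)"
    by (simp_all add: pt dist_pt m_def n_def)
  have ge: "1 \<le> dist p r" "1 \<le> dist r q"
    using assms by (auto intro: dist_lattice_ge_1)
  have "real_of_int ((x' - x)\<^sup>2 + (y' - y)\<^sup>2) = 1"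
    using assms(6) by (simp add: pt dist_pt)
  then have "(x' - x)\<^sup>2 + (y' - y)\<^sup>2 = 1" by linarith
  then have "odd ((x' - x)\<^sup>2 + (y' - y)\<^sup>2)" by simp
  \<comment> \<open>Squaring preserves parity, and the two legs add up coordinatewise to
    \<open>(x' - x, y' - y)\<close>.\<close>
  then have "odd (m + n)" unfolding m_def n_def by (simp add: power2_eq_square) blast
  moreover have "1 \<le> m" "1 \<le> n" using ge unfolding d by simp_all
  ultimately have "2 \<le> m \<or> 2 \<le> n" by (cases "m = 1"; cases "n = 1") auto
  then have "sqrt 2 \<le> dist p r \<or> sqrt 2 \<le> dist r q" unfolding d by auto
  then show ?thesis using ge by linarith
qed

lemma path_len_nonadjacent:
  assumes geo: "geometric_graph square_lattice E" and path: "graph_path E p xs q"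
    and pq: "p \<in> square_lattice" "q \<in> square_lattice" "dist p q = 1" "{p, q} \<notin> E"
  shows "1 + sqrt 2 \<le> path_len xs"
proof -
  have edge: "a \<in> square_lattice \<and> b \<in> square_lattice \<and> a \<noteq> b" if "{a, b} \<in> E" for a b
    using geo that unfolding geometric_graph_def by (auto simp: card_2_iff)
  have long: "1 \<le> dist a b" if "{a, b} \<in> E" for a b
    using dist_lattice_ge_1 edge[OF that] by blast
  have P: "hd xs = p" "last xs = q" "xs \<noteq> []" "successively (\<lambda>x y. {x, y} \<in> E) xs"
    using path unfolding graph_path_def by auto
  \<comment> \<open>The cases are zero, one, two and at least three edges; the first two contradict
    \<open>dist p q = 1\<close> and the missing edge.\<close>
  consider a where "xs = [a]" | a b where "xs = [a, b]" | a b c where "xs = [a, b, c]"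
    | a b c d zs where "xs = a # b # c # d # zs"
    using P(3) by (metis list.exhaust)
  then show ?thesis
  proof cases
    case 1
    then show ?thesis using P pq(3) by auto
  next
    case 2
    then show ?thesis using P pq(4) by auto
  next
    case 3
    then have "{p, b} \<in> E" "{b, q} \<in> E" "xs = [p, b, q]" using P by auto
    then show ?thesis
      using two_leg_detour[of p q b] edge pq by (simp add: path_len_Cons path_len_singleton)
  next
    case 4
    then have "{a, b} \<in> E" "{b, c} \<in> E" "{c, d} \<in> E" using P by auto
    then have "3 \<le> path_len xs"
      using long[of a b] long[of b c] long[of c d] path_len_nonneg[of "d # zs"]
      unfolding 4 path_len_Cons by linarith
    moreover have "sqrt 2 \<le> 2" using real_sqrt_le_mono[of 2 4] by simp
    ultimately show ?thesis by linarith
  qed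
qed

text \<open>Pigeonhole at the origin: four unit segments compete for at most three incident edges.
  The endpoints of a missing one are at distance 1, so their dilation equals their graph
  distance.\<close>

lemma dilation_ge:
  assumes geo: "geometric_graph square_lattice E" and deg: "max_degree_le 3 square_lattice E"
  shows "ereal (1 + sqrt 2) \<le> dilation square_lattice E"
proof -
  define S where "S = {{pt 0 0, pt 1 0}, {pt 0 0, pt 0 1}, {pt 0 0, pt (-1) 0}, {pt 0 0, pt 0 (-1)}}"
  have "pt 0 0 \<in> square_lattice" by (auto simp: square_lattice_eq)
  then have fin: "finite {e \<in> E. pt 0 0 \<in> e}" "card {e \<in> E. pt 0 0 \<in> e} \<le> 3"
    using deg unfolding max_degree_le_def by auto
  have "card S = 4" unfolding S_def by (simp add: doubleton_eq_iff)
  then have "\<not> S \<subseteq> {e \<in> E. pt 0 0 \<in> e}"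
    using card_mono[OF fin(1), of S] fin(2) by linarith
  then obtain x y where xy: "{pt 0 0, pt x y} \<notin> E" "x\<^sup>2 + y\<^sup>2 = 1"
    unfolding S_def by fastforce
  define p q where "p = pt 0 0" and "q = pt x y"
  have pq: "p \<in> square_lattice" "q \<in> square_lattice" "dist p q = 1" "{p, q} \<notin> E" "p \<noteq> q"
    using xy by (auto simp: p_def q_def square_lattice_eq dist_pt)
  have "ereal (1 + sqrt 2) \<le> graph_dist E p q"
    unfolding graph_dist_def
    using path_len_nonadjacent[OF geo _ pq(1-4)] by (auto intro!: INF_greatest)
  also have "\<dots> = dilation_between E p q"
    by (simp add: dilation_between_def pq one_ereal_def[symmetric])
  also have "\<dots> \<le> dilation square_lattice E"
    unfolding dilation_def using pq by (intro SUP_upper2[of "(p, q)"]) auto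
  finally show ?thesis .
qed

section \<open>An optimal graph\<close>

text \<open>
  The neighbours of \<open>pt x y\<close> are determined by the residue of \<open>x - 2 * y\<close> modulo 8. This periodic
  graph was found by a computer search.
\<close>

definition moves :: "int \<Rightarrow> (int \<times> int) list" where
  "moves c = [
    [(0, 1), (1, -1), (-1, 1)],
    [(0, 1), (1, -1), (0, -1)],
    [(1, 0), (1, -1), (0, -1)],
    [(0, 1), (-1, 0), (-1, 1)],
    [(0, 1), (0, -1), (-1, 1)],
    [(1, -1), (0, -1), (-1, 1)],
    [(0, 1), (1, 0), (0, -1)],
    [(0, 1), (0, -1), (-1, 0)]] ! nat (c mod 8)"

definition optimal_graph :: "(real^2) set set" where
  "optimal_graph = {{pt x y, pt (x + a) (y + b)} | x y a b. (a, b) \<in> set (moves (x - 2 * y))}"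

section \<open>Symmetry of the move table and the degree bound\<close>

lemma moves_mod: "moves (c mod 8) = moves c"
  by (simp add: moves_def)

text \<open>Turns a claim about all residue classes into a finite one that \<open>code_simp\<close>
  can evaluate.\<close>

lemma all_classes:
  assumes "list_all P [0, 1, 2, 3, 4, 5, 6, 7]"
  shows "P ((c::int) mod 8)"
proof -
  have "c mod 8 \<in> {0..<8}" by simp
  also have "{0..<8::int} = set [0, 1, 2, 3, 4, 5, 6, 7]" by auto
  finally show ?thesis using assms by (auto simp: list_all_iff)
qed

lemma length_moves: "length (moves c) = 3"
proof -
  have "length (moves (c mod 8)) = 3" by (rule all_classes) code_simp
  then show ?thesis by (simp add: moves_mod)
qed

text \<open>The move \<open>(a, b)\<close> changes the class by \<open>a - 2 * b\<close>, and the
  table lists the reverse move there. Hence the move list of a vertex accounts for all of its edges,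
  including those listed from the other end.\<close>

lemma moves_sym:
  assumes "(a, b) \<in> set (moves c)"
  shows "(-a, -b) \<in> set (moves (c + a - 2 * b))"
proof -
  have "list_all (\<lambda>(a, b). (-a, -b) \<in> set (moves (c mod 8 + a - 2 * b))) (moves (c mod 8))"
    by (rule all_classes) code_simp
  then have "(-a, -b) \<in> set (moves (c mod 8 + a - 2 * b))"
    using assms by (auto simp: moves_mod list_all_iff)
  moreover have "moves (c mod 8 + a - 2 * b) = moves (c + a - 2 * b)"
    by (metis moves_mod mod_add_left_eq mod_diff_left_eq)
  ultimately show ?thesis by simp
qed

text \<open>All edges belong to the grid triangulated by the diagonals \<open>(1, -1)\<close>; this
  yields both planarity and the two possible step lengths, 1 and \<open>sqrt 2\<close>.\<close>

lemma moves_cases: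
  assumes "(a, b) \<in> set (moves c)"
  shows "(a, b) \<in> {(1, 0), (0, 1), (1, -1), (-1, 0), (0, -1), (-1, 1)}"
proof -
  have "list_all (\<lambda>v. v \<in> set [(1, 0), (0, 1), (1, -1), (-1, 0), (0, -1), (-1, 1)]) (moves (c mod 8))"
    by (rule all_classes) code_simp
  then show ?thesis using assms by (auto simp: moves_mod list_all_iff)
qed

lemma optimal_graph_geometric: "geometric_graph square_lattice optimal_graph"
  unfolding geometric_graph_def
proof
  fix e assume "e \<in> optimal_graph"
  then obtain x y a b where e: "e = {pt x y, pt (x + a) (y + b)}" and "(a, b) \<in> set (moves (x - 2 * y))"
    unfolding optimal_graph_def by blast
  then have "pt x y \<noteq> pt (x + a) (y + b)" using moves_cases by fastforce
  then show "e \<subseteq> square_lattice \<and> card e = 2" by (auto simp: e square_lattice_eq)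
qed

lemma optimal_graph_degree: "max_degree_le 3 square_lattice optimal_graph"
  unfolding max_degree_le_def
proof
  fix p assume "p \<in> square_lattice"
  then obtain x y where p: "p = pt x y" by (auto simp: square_lattice_eq)
  define S where "S = (\<lambda>(a, b). {pt x y, pt (x + a) (y + b)}) ` set (moves (x - 2 * y))"
  have sub: "{e \<in> optimal_graph. p \<in> e} \<subseteq> S"
  proof
    fix e assume "e \<in> {e \<in> optimal_graph. p \<in> e}"
    then obtain x' y' a b where e: "e = {pt x' y', pt (x' + a) (y' + b)}"
      and ab: "(a, b) \<in> set (moves (x' - 2 * y'))" and "p \<in> e"
      unfolding optimal_graph_def by blast
    then consider "x = x'" "y = y'" | "x = x' + a" "y = y' + b" by (auto simp: p)
    then show "e \<in> S"
    proof cases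
      case 1
      then show ?thesis using ab by (auto simp: S_def e)
    next
      case 2
      then have "(-a, -b) \<in> set (moves (x - 2 * y))"
        using moves_sym[OF ab] by (simp add: algebra_simps)
      then show ?thesis unfolding S_def by (intro image_eqI[of _ _ "(-a, -b)"]) (auto simp: e 2)
    qed
  qed
  have "finite S" unfolding S_def by simp
  have "card S \<le> card (set (moves (x - 2 * y)))"
    unfolding S_def by (rule card_image_le) simp
  then have "card S \<le> 3"
    using card_length[of "moves (x - 2 * y)"] by (simp add: length_moves)
  then show "finite {e \<in> optimal_graph. p \<in> e} \<and> card {e \<in> optimal_graph. p \<in> e} \<le> 3"
    using finite_subset[OF sub \<open>finite S\<close>] card_mono[OF \<open>finite S\<close> sub] by linarith
qed

section \<open>Planarity: edges of the triangulated grid meet only at endpoints\<close>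

lemma optimal_graph_oriented:
  assumes "e \<in> optimal_graph"
  obtains x y a b where "e = {pt x y, pt (x + a) (y + b)}" "(a, b) \<in> {(1, 0), (0, 1), (1, -1)}"
proof -
  obtain x y a b where e: "e = {pt x y, pt (x + a) (y + b)}" and "(a, b) \<in> set (moves (x - 2 * y))"
    using assms unfolding optimal_graph_def by blast
  from moves_cases[OF this(2)]
  have "(a, b) \<in> {(1, 0), (0, 1), (1, -1)} \<or> (-a, -b) \<in> {(1, 0), (0, 1), (1, -1)}" by auto
  then show thesis
  proof
    assume "(a, b) \<in> {(1, 0), (0, 1), (1, -1)}"
    then show thesis using that e by blast
  next
    assume "(-a, -b) \<in> {(1, 0), (0, 1), (1, -1)}"
    moreover have "e = {pt (x + a) (y + b), pt (x + a + -a) (y + b + -b)}"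
      unfolding e by (simp add: insert_commute)
    ultimately show thesis using that by blast
  qed
qed

lemma mem_hull_pt:
  assumes "z \<in> convex hull {pt x y, pt (x + a) (y + b)}"
  obtains s :: real where "0 \<le> s" "s \<le> 1" "z $ 1 = x + s * a" "z $ 2 = y + s * b"
proof -
  obtain s where "0 \<le> s" "s \<le> 1" "z = (1 - s) *\<^sub>R pt x y + s *\<^sub>R pt (x + a) (y + b)"
    using assms by (auto simp: segment_convex_hull[symmetric] in_segment)
  then show thesis using that[of s] by (simp add: left_diff_distrib distrib_left)
qed

lemma unit_interval_Ints: "0 \<le> s \<Longrightarrow> s \<le> 1 \<Longrightarrow> s = real_of_int k \<Longrightarrow> s = 0 \<or> s = 1"
  by (cases "k \<le> 0"; cases "k = 1") auto

text \<open>Two different directions have determinant 1 or -1, so the linear system for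
  \<open>s\<close> and \<open>t\<close> has an integer solution, and integers in the unit interval
  are 0 or 1. For equal directions \<open>t - s\<close> is an integer, nonzero if the edges differ,
  so one parameter is 0 and the other 1.\<close>

lemma triangular_edges_meet:
  assumes "(a, b) \<in> {(1, 0), (0, 1), (1, -1)}" "(c, d) \<in> {(1, 0), (0, 1), (1, -1::int)}"
    and s: "0 \<le> s" "s \<le> 1" and t: "0 \<le> t" "t \<le> 1"
    and X: "real_of_int x + s * real_of_int a = real_of_int u + t * real_of_int c"
    and Y: "real_of_int y + s * real_of_int b = real_of_int v + t * real_of_int d"
  shows "(x, y, a, b) = (u, v, c, d) \<or> (s = 0 \<or> s = 1) \<and> (t = 0 \<or> t = 1)"
proof (cases "(a, b) = (c, d)")
  case True
  show ?thesis
  proof (cases "x = u \<and> y = v")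
    case False
    have "\<exists>k. k \<noteq> 0 \<and> t - s = real_of_int k"
      using assms(1) True X Y False
      by (auto intro: exI[of _ "x - u"] exI[of _ "y - v"] simp: algebra_simps)
    then obtain k where k: "k \<noteq> 0" "t - s = real_of_int k" by blast
    then have "k = 1 \<or> k = -1" using s t
      by (smt (verit, best) of_int_le_1_iff of_int_minus of_int_1 of_int_le_iff)
    then show ?thesis using k s t by auto
  qed (use True in auto)
next
  case False
  have "\<exists>k l. s = real_of_int k \<and> t = real_of_int l"
  proof -
    have "s = real_of_int (u - x) \<or> s = real_of_int (v - y) \<or> s = real_of_int (y - v) \<or> s = real_of_int (u + v - x - y)"
      "t = real_of_int (x - u) \<or> t = real_of_int (y - v) \<or> t = real_of_int (v - y) \<or> t = real_of_int (x + y - u - v)"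
      using assms(1,2) False X Y by auto
    then show ?thesis by blast
  qed
  then show ?thesis using unit_interval_Ints s t by blast
qed

lemma optimal_graph_plane: "plane_drawing optimal_graph"
  unfolding plane_drawing_def
proof (intro ballI impI subsetI)
  fix e f z
  assume ef: "e \<in> optimal_graph" "f \<in> optimal_graph" "e \<noteq> f" "z \<in> convex hull e \<inter> convex hull f"
  obtain x y a b where e: "e = {pt x y, pt (x + a) (y + b)}" "(a, b) \<in> {(1, 0), (0, 1), (1, -1)}"
    using optimal_graph_oriented[OF ef(1)] by blast
  obtain u v c d where f: "f = {pt u v, pt (u + c) (v + d)}" "(c, d) \<in> {(1, 0), (0, 1), (1, -1)}"
    using optimal_graph_oriented[OF ef(2)] by blast
  obtain s :: real where s: "0 \<le> s" "s \<le> 1" "z $ 1 = x + s * a" "z $ 2 = y + s * b"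
    by (rule mem_hull_pt[of z x y a b]) (use ef(4) e(1) in auto)
  obtain t :: real where t: "0 \<le> t" "t \<le> 1" "z $ 1 = u + t * c" "z $ 2 = v + t * d"
    by (rule mem_hull_pt[of z u v c d]) (use ef(4) f(1) in auto)
  have "(s = 0 \<or> s = 1) \<and> (t = 0 \<or> t = 1)"
    using triangular_edges_meet[OF e(2) f(2) s(1,2) t(1,2), of x u y v] s(3,4) t(3,4) ef(3) e(1) f(1)
    by auto
  then have "z \<in> e" "z \<in> f"
    using s t by (auto simp: e f vec_eq_iff forall_2)
  then show "z \<in> e \<inter> f" by blast
qed

section \<open>Certified walks\<close>

text \<open>
  A walk from a vertex of class \<open>c\<close> is encoded by indices into the successive move lists. Its value
  consists of the displacement and the numbers of unit and of diagonal steps.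
\<close>

fun walk :: "int \<Rightarrow> nat list \<Rightarrow> int \<times> int \<times> int \<times> int" where
  "walk c [] = (0, 0, 0, 0)"
| "walk c (k # ks) =
    (let (a, b) = moves c ! (k mod 3); (x, y, m, n) = walk (c + a - 2 * b) ks
     in (a + x, b + y, if a = 0 \<or> b = 0 then (m + 1, n) else (m, n + 1)))"

type_synonym cost_vector = "int \<times> int \<times> int \<times> int"

text \<open>
  The tuple \<open>(x, y, m, n)\<close> stands for the displacement \<open>(x, y)\<close> with length \<open>m + n * sqrt 2\<close>.
  Each list of eight walks is indexed by the class of the starting vertex.
  The \<open>i\<close>-th entry of \<open>residues\<close> belongs to the cone spanned by the \<open>i\<close>-th highway and its successor;
  the displacements are the lattice points of the half-open parallelogram on these two vectors.
\<close>

definition highways :: "(cost_vector \<times> nat list list) list" where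
  "highways = [
    ((2, 1, 3, 1), [[0,1,0,0], [1,0,0,0], [0,0,1,0], [0,1,0,0], [0,0,0,1], [0,0,1,0], [1,0,0,0], [0,0,0,1]]),
    ((2, 5, 7, 1), [[0,0,0,0,0,0,0,0], [0,0,0,0,0,0,0,0], [0,0,0,0,0,0,0,0], [0,0,0,0,0,0,0,0], [0,0,0,0,0,0,0,0], [0,0,0,0,0,0,0,0], [0,0,0,0,0,0,0,0], [0,0,0,0,0,0,0,0]]),
    ((0, 4, 4, 1), [[0,0,0,0,2], [0,0,2,0,0], [0,0,0,0,2], [0,0,0,2,0], [0,0,2,0,0], [2,0,0,0,0], [0,0,0,2,0], [0,2,0,0,0]]),
    ((-2, 3, 1, 3), [[2,2,0,2], [0,2,0,2], [0,2,2,2], [2,2,2,0], [2,0,2,0], [2,0,2,2], [0,2,0,2], [2,0,2,0]]),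
    ((-4, 2, 4, 3), [[2,2,2,2,2,2], [2,2,2,2,2,2], [2,2,2,2,2,2], [2,2,2,2,2,2], [2,2,2,2,2,2], [2,2,2,2,2,2], [0,2,2,2,2,1,2], [2,0,2,2,2,2,1]]),
    ((-6, 1, 5, 5), [[2,1,2,2,2,2,2,2,2,2], [2,1,2,2,2,2,2,2,2,2], [2,2,2,1,2,2,2,2,2,2], [1,2,2,2,2,2,2,2,2,2], [2,2,1,2,2,2,2,2,2,2], [1,2,2,2,2,2,2,2,2,2], [2,2,2,2,2,2,2,2,1,2], [2,2,2,2,2,2,2,2,2,1]]),
    ((-2, -1, 3, 1), [[2,1,2,2], [2,1,2,2], [2,2,2,1], [1,2,2,2], [2,2,1,2], [1,2,2,2], [2,2,1,2], [2,2,2,1]])]"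

definition residues :: "((int \<times> int) \<times> nat list list) list list" where
  "residues = [
   [((0, 0), [[], [], [], [], [], [], [], []]),
    ((1, 1), [[0,1], [0,0,0], [0,0], [0,1,0], [0,0], [0,0,0], [1,0], [0,0,0]]),
    ((1, 2), [[0,1,0], [0,0,0,0], [0,0,0], [0,0,0,0], [0,0,0], [0,0,0,0], [0,0,0], [0,0,0,0]]),
    ((2, 2), [[0,1,0,0,0], [0,0,0,0,1], [0,0,0,0,0], [0,1,0,0,0], [0,0,0,1,0], [0,0,0,0,0], [0,0,0,0,1], [0,0,0,1,0]]),
    ((2, 3), [[0,0,0,0,0,1], [0,0,0,0,1,0], [0,0,0,0,0,0], [0,0,0,0,0,1], [0,0,0,0,0,0], [0,0,0,0,0,0], [0,0,0,0,1,0], [0,0,0,0,0,0]]),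
    ((2, 4), [[0,0,0,0,0,1,0], [0,0,0,0,0,0,0], [0,0,0,0,0,0,0], [0,0,0,0,0,1,0], [0,0,0,0,0,0,0], [0,0,0,0,0,0,0], [0,0,0,0,0,0,0], [0,0,0,0,0,0,0]]),
    ((3, 4), [[0,0,0,0,0,1,0,0], [0,0,0,0,0,0,0,0,1], [0,0,0,0,0,0,1,0], [0,0,0,0,0,1,0,0,0], [0,0,0,0,0,0,0,1], [0,0,0,0,0,0,0,0,0], [0,0,0,0,1,0,0,0], [0,0,0,0,0,0,0,1,0]]),
    ((3, 5), [[0,0,0,0,0,1,0,0,0], [0,0,0,0,0,0,0,0,1,0], [0,0,0,0,0,0,0,0,0], [0,0,0,0,0,0,0,0,0,1], [0,0,0,0,0,0,0,1,0], [0,0,0,0,0,0,0,0,0,0], [0,0,0,0,0,0,0,0,1], [0,0,0,0,0,0,0,0,0,0]])],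
   [((0, 0), [[], [], [], [], [], [], [], []]),
    ((0, 1), [[0], [0], [0,2], [0], [0], [2,0], [0], [0]]),
    ((0, 2), [[0,0], [0,0], [0,2,0], [0,0], [0,0,2], [2,0,0], [0,0], [0,2,0]]),
    ((0, 3), [[0,0,0], [0,0,2,0], [0,2,0,0], [0,0,0], [0,0,2,0], [2,0,0,0], [0,0,0,2], [0,2,0,0]]),
    ((1, 3), [[0,0,0,0], [0,0,0,0,0], [0,0,0,0], [0,0,0,0,0], [0,0,0,0], [0,0,0,0,0,2], [0,0,0,0], [0,0,0,0,0]]),
    ((1, 4), [[0,0,0,0,0], [0,0,0,0,0,0], [0,0,0,0,2,0], [0,0,0,0,0,0], [0,0,0,0,0], [0,0,0,0,0,2,0], [0,0,0,0,0], [0,0,0,0,0,0,2]]),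
    ((1, 5), [[0,0,0,0,0,0], [0,0,0,0,0,0,0,2], [0,0,0,0,2,0,0], [0,0,0,0,0,0,0], [0,0,0,0,0,2,0], [0,0,0,0,0,2,0,0], [0,0,0,0,0,0], [0,0,0,0,0,0,2,0]]),
    ((1, 6), [[0,0,0,0,0,0,0], [0,0,0,0,0,0,0,2,0], [0,0,0,0,2,0,0,0], [0,0,0,0,0,0,0,0,2], [0,0,0,0,0,2,0,0], [0,0,0,0,0,0,0,0,2], [0,0,0,0,0,0,2,0], [0,0,0,0,0,0,2,0,0]])],
   [((-1, 2), [[2,2,0], [0,2,0], [0,2,2], [2,0], [2,0], [2,0,2], [0,2], [0,2]]),
    ((-1, 3), [[0,0,2], [0,0,2], [0,2,2,2,0], [2,0,0], [2,0,0], [2,0,2,0], [0,2,0], [0,2,0,2]]),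
    ((-1, 4), [[0,0,2,0], [0,0,2,0,2], [0,2,0,0,2], [0,0,0,2], [2,0,0,2,0], [2,0,2,0,0], [0,2,0,0], [0,2,0,2,0]]),
    ((-1, 5), [[0,0,2,0,0], [0,0,2,0,2,0], [0,2,0,0,2,0], [0,0,0,2,0,2], [0,0,2,0,0,2], [2,0,0,0,0,2], [0,2,0,0,2,0], [0,2,0,2,0,0]]),
    ((0, 0), [[], [], [], [], [], [], [], []]),
    ((0, 1), [[0], [0], [0,2], [0], [0], [2,0], [0], [0]]),
    ((0, 2), [[0,0], [0,0], [0,2,0], [0,0], [0,0,2], [2,0,0], [0,0], [0,2,0]]),
    ((0, 3), [[0,0,0], [0,0,2,0], [0,2,0,0], [0,0,0], [0,0,2,0], [2,0,0,0], [0,0,0,2], [0,2,0,0]])],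
   [((-5, 4), [[2,2,2,2,0,2,0,2,2], [0,2,0,2,2,2,2,2,2], [2,2,0,2,0,2,2,2,2], [2,2,2,2,2,0,2], [2,2,2,2,2,2,2,0], [2,2,2,0,2,0,2,2,2], [0,2,2,2,2,2,2,2], [2,0,2,2,2,2,2]]),
    ((-4, 3), [[2,2,2,2,0,2], [2,2,2,2,2,2,0], [2,2,0,2,0,2,2,2], [2,2,2,2,2], [2,2,2,2,2], [2,2,2,0,2,0,2,2], [0,2,2,2,2,2,2], [2,0,2,2,2,2]]),
    ((-3, 2), [[2,2,2,2], [2,2,2,2], [2,2,0,2,0,2,2], [2,2,2,2], [2,2,2,2], [2,2,2,0,2], [0,2,2,2,2,1], [2,0,2,2,2]]),
    ((-3, 3), [[2,2,2,2,0], [0,2,0,2,2,2], [2,2,0,2,0,2], [2,2,2], [2,0,2,0,2,2], [2,2,2,0,2,0], [0,2,2,2,2], [2,0,2,0,2]]),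
    ((-2, 1), [[2,2,2], [2,2,2], [2,2,0,2], [2,2,1], [2,2,2], [2,2,2], [2,2,2], [2,0,2,2]]),
    ((-2, 2), [[2,2], [0,2,0,2,2], [2,2,0,2,0], [2,2], [2,0,2], [2,2,2,0], [0,2,2,2], [2,0,2]]),
    ((-1, 1), [[2], [0,2], [2,2,0], [2], [2], [2], [0,2,2], [2,0]]),
    ((0, 0), [[], [], [], [], [], [], [], []])],
   [((-7, 2), [[2,1,2,2,2,2,2,2,2,2,2], [2,2,2,2,2,2,2,2,2,1,2], [2,2,2,2,2,2,2,2,2,2,2,1], [1,2,2,2,2,2,2,2,2,2,2], [2,2,1,2,2,2,2,2,2,2,2], [1,2,2,2,2,2,2,2,2,2,2], [2,2,2,2,2,2,2,2,2,2,2,2], [2,2,2,2,2,2,2,2,2,2,2]]),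
    ((-6, 2), [[2,2,2,2,2,2,2,1,2], [2,2,2,2,2,2,2,2,2,1], [2,2,2,2,2,2,2,2,2,2], [1,2,2,2,2,2,2,2,2], [2,2,1,2,2,2,2,2,2], [2,2,2,2,2,2,2,2,2,2], [2,2,2,2,2,2,2,2,2,2], [2,2,2,2,2,2,2,2,2]]),
    ((-5, 1), [[2,1,2,2,2,2,2,2], [2,1,2,2,2,2,2,2], [2,2,2,2,2,2,2,2,2], [1,2,2,2,2,2,2,2], [2,2,1,2,2,2,2,2], [2,2,2,2,2,2,1,2], [2,2,2,2,2,2,2,2,1], [2,2,2,2,2,2,2,2]]),
    ((-5, 2), [[2,2,2,2,2,2,2,1], [2,2,2,2,2,2,2,2], [2,2,2,2,2,2,2,2], [1,2,2,2,2,2,2], [2,2,2,2,2,2,2,2], [2,2,2,2,2,2,2,2], [2,2,2,2,2,2,2,2], [2,0,2,2,2,2,1,2]]),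
    ((-4, 1), [[2,1,2,2,2,2], [2,2,2,2,2,2,2], [2,2,2,2,2,2,2], [1,2,2,2,2,2], [2,2,2,2,1,2], [2,2,2,2,2,2,1], [2,2,2,2,2,2,2], [2,2,2,2,2,2]]),
    ((-3, 1), [[2,2,2,2,2], [2,2,2,2,2], [2,2,2,2,2], [2,2,1,2], [2,2,2,2,1], [2,2,2,2,2], [2,2,2,2,2], [2,2,2,2]]),
    ((-2, 1), [[2,2,2], [2,2,2], [2,2,0,2], [2,2,1], [2,2,2], [2,2,2], [2,2,2], [2,0,2,2]]),
    ((0, 0), [[], [], [], [], [], [], [], []])],
   [((-7, 0), [[2,1,2,2,2,1,2,2,2,2,2,2], [2,1,2,2,2,1,2,2,2,2,2,2], [2,2,2,1,2,2,2,2,2,2,2,2,2], [1,2,2,2,1,2,2,2,2,2,2,2], [2,2,1,2,2,2,1,2,2,2,2,2], [1,2,2,2,2,2,2,2,2,2,1,2], [2,2,1,2,2,2,2,2,2,2,2,2,1], [2,2,2,1,2,2,2,2,2,2,2,2]]),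
    ((-6, 0), [[2,1,2,2,2,1,2,2,2,2], [2,1,2,2,2,2,2,2,2,2,2], [2,2,2,1,2,2,2,2,2,2,2], [1,2,2,2,1,2,2,2,2,2], [2,2,1,2,2,2,2,2,1,2], [1,2,2,2,2,2,2,2,2,2,1], [2,2,1,2,2,2,2,2,2,2,2], [2,2,2,1,2,2,2,2,2,2]]),
    ((-5, 0), [[2,1,2,2,2,2,2,2,2], [2,1,2,2,2,2,2,2,2], [2,2,2,1,2,2,2,2,2], [1,2,2,2,2,2,1,2], [2,2,1,2,2,2,2,2,1], [1,2,2,2,2,2,2,2,2], [2,2,1,2,2,2,2,2,2], [2,2,2,1,2,2,2,2]]),
    ((-4, 0), [[2,1,2,2,2,2,2], [2,1,2,2,2,2,2], [2,2,2,2,2,1,2], [1,2,2,2,2,2,1], [2,2,1,2,2,2,2], [1,2,2,2,2,2,2], [2,2,1,2,2,2,2], [2,2,2,2,2,2,2]]),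
    ((-3, 0), [[2,1,2,2,2], [2,2,2,1,2], [2,2,2,2,2,1], [1,2,2,2,2], [2,2,1,2,2], [1,2,2,2,2], [2,2,2,2,2,2], [2,2,2,2,2]]),
    ((-2, 0), [[2,1,2], [2,2,2,1], [2,2,2,2], [1,2,2], [2,2,1], [2,2,2,2], [2,2,2,2], [2,2,2]]),
    ((-1, 0), [[2,1], [2,2], [2,2], [1], [2,2], [2,2], [2,2], [2]]),
    ((0, 0), [[], [], [], [], [], [], [], []])]]"


text \<open>Because of this periodicity, eight walks serve all lattice points as starting
  vertices.\<close>

lemma walk_mod: "walk (c mod 8) ks = walk c ks"
proof (induction ks arbitrary: c)
  case (Cons k ks)
  obtain a b where ab: "moves c ! (k mod 3) = (a, b)" by fastforce
  have "walk (c mod 8 + a - 2 * b) ks = walk ((c mod 8 + a - 2 * b) mod 8) ks"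
    by (simp only: Cons.IH)
  also have "(c mod 8 + a - 2 * b) mod 8 = (c + a - 2 * b) mod 8"
    by (metis mod_add_left_eq mod_diff_left_eq)
  also have "walk \<dots> ks = walk (c + a - 2 * b) ks" by (simp only: Cons.IH)
  finally show ?case by (simp add: moves_mod ab)
qed simp

section \<open>Exact lengths of the form \<open>m + n * sqrt 2\<close>\<close>

definition cost :: "int \<Rightarrow> int \<Rightarrow> real" where
  "cost m n = of_int m + of_int n * sqrt 2"

lemma reach_walk:
  "walk (x - 2 * y) ks = (a, b, m, n) \<Longrightarrow>
    reach optimal_graph (pt x y) (pt (x + a) (y + b)) (cost m n)"
proof (induction ks arbitrary: x y a b m n)
  case Nil
  then show ?case by (simp add: cost_def reach_refl)
next
  case (Cons k ks)
  obtain a' b' where ab: "moves (x - 2 * y) ! (k mod 3) = (a', b')" by fastforce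
  \<comment> \<open>Every move list has length 3, so reducing the index modulo 3 makes every list of
    naturals a valid walk.\<close>
  then have mem: "(a', b') \<in> set (moves (x - 2 * y))"
    by (metis length_moves mod_less_divisor nth_mem zero_less_numeral)
  obtain a'' b'' m' n' where w: "walk ((x + a') - 2 * (y + b')) ks = (a'', b'', m', n')"
    by (metis prod_cases4)
  then have "walk (x - 2 * y + a' - 2 * b') ks = (a'', b'', m', n')"
    by (simp add: algebra_simps)
  then have eq: "a = a' + a''" "b = b' + b''"
      "(m, n) = (if a' = 0 \<or> b' = 0 then (m' + 1, n') else (m', n' + 1))"
    using Cons.prems ab by (auto simp: Let_def split: if_splits)
  have "{pt x y, pt (x + a') (y + b')} \<in> optimal_graph"
    using mem unfolding optimal_graph_def by blast
  moreover have "dist (pt x y) (pt (x + a') (y + b')) + cost m' n' \<le> cost m n"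
    using moves_cases[OF mem] eq(3) by (auto simp: dist_pt cost_def algebra_simps)
  moreover have "reach optimal_graph (pt (x + a') (y + b')) (pt (x + a) (y + b)) (cost m' n')"
    using Cons.IH[OF w] by (simp add: eq algebra_simps)
  ultimately show ?case by (blast intro: reach_step)
qed

text \<open>An integer sign test for \<open>p + q * sqrt 2\<close>: when \<open>p\<close> and
  \<open>q\<close> have opposite signs, comparing \<open>p * p\<close> with
  \<open>2 * (q * q)\<close> decides.\<close>

definition surd_nonneg :: "int \<Rightarrow> int \<Rightarrow> bool" where
  "surd_nonneg p q \<longleftrightarrow>
    0 \<le> p \<and> (0 \<le> q \<or> 2 * (q * q) \<le> p * p) \<or> 0 \<le> q \<and> p * p \<le> 2 * (q * q)"

lemma surd_nonneg: "surd_nonneg p q \<Longrightarrow> 0 \<le> cost p q"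
proof -
  assume "surd_nonneg p q"
  then consider "0 \<le> p" "0 \<le> q" | "0 \<le> p" "2 * (q * q) \<le> p * p"
    | "0 \<le> q" "p * p \<le> 2 * (q * q)"
    unfolding surd_nonneg_def by blast
  then show "0 \<le> cost p q"
  proof cases
    case 2
    then have "real_of_int (2 * (q * q)) \<le> real_of_int (p * p)" by linarith
    then have "(real_of_int q * sqrt 2)\<^sup>2 \<le> (real_of_int p)\<^sup>2"
      by (simp add: power2_eq_square algebra_simps)
    then have "\<bar>real_of_int q * sqrt 2\<bar> \<le> \<bar>real_of_int p\<bar>" by (simp only: abs_le_square_iff)
    then show ?thesis using 2 unfolding cost_def by linarith
  next
    case 3
    then have "real_of_int (p * p) \<le> real_of_int (2 * (q * q))" by linarith
    then have "(real_of_int p)\<^sup>2 \<le> (real_of_int q * sqrt 2)\<^sup>2"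
      by (simp add: power2_eq_square algebra_simps)
    then have "\<bar>real_of_int p\<bar> \<le> \<bar>real_of_int q * sqrt 2\<bar>" by (simp only: abs_le_square_iff)
    moreover have "0 \<le> real_of_int q * sqrt 2" using 3 by simp
    ultimately show ?thesis unfolding cost_def by linarith
  qed (simp add: cost_def)
qed

text \<open>Uses \<open>(1 + sqrt 2)\<^sup>2 = 3 + 2 * sqrt 2\<close> to stay within integer arithmetic.\<close>

fun compatible :: "cost_vector \<Rightarrow> cost_vector \<Rightarrow> bool" where
  "compatible (x, y, m, n) (x', y', m', n') \<longleftrightarrow>
    (let g = x * x' + y * y' in surd_nonneg (3 * g - m * m' - 2 * n * n') (2 * g - m * n' - n * m'))"

lemma compatible:
  assumes "compatible (x, y, m, n) (x', y', m', n')"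
  shows "cost m n * cost m' n' \<le> (1 + sqrt 2)\<^sup>2 * of_int (x * x' + y * y')"
proof -
  define g where "g = x * x' + y * y'"
  have "0 \<le> cost (3 * g - m * m' - 2 * n * n') (2 * g - m * n' - n * m')"
    using assms surd_nonneg by (simp add: Let_def g_def)
  also have "\<dots> = (1 + sqrt 2)\<^sup>2 * of_int g - cost m n * cost m' n'"
    unfolding cost_def by (simp add: power2_eq_square algebra_simps)
  finally show ?thesis by (simp add: g_def)
qed

section \<open>Finite checks of the tables\<close>

definition classes :: "int list" where
  "classes = [0, 1, 2, 3, 4, 5, 6, 7]"

text \<open>The declared length bounds all eight walks, so a highway enters the compatibility checks
  with one length, whatever the class of the vertex where it starts.\<close>

fun highway_ok :: "cost_vector \<times> nat list list \<Rightarrow> bool" where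
  "highway_ok ((x, y, m, n), ps) \<longleftrightarrow>
    list_all (\<lambda>c. case walk c (ps ! nat c) of (x', y', m', n') \<Rightarrow>
      x' = x \<and> y' = y \<and> surd_nonneg (m - m') (n - n')) classes"

text \<open>A residue is walked only once, at the beginning, so each class can be tested with the
  length of its own walk.\<close>

fun residue_ok :: "cost_vector \<Rightarrow> cost_vector \<Rightarrow> (int \<times> int) \<times> nat list list \<Rightarrow> bool" where
  "residue_ok g h ((x, y), ps) \<longleftrightarrow>
    list_all (\<lambda>c. case walk c (ps ! nat c) of (x', y', m, n) \<Rightarrow>
      x' = x \<and> y' = y \<and> compatible (x, y, m, n) (x, y, m, n) \<and>
      compatible g (x, y, m, n) \<and> compatible h (x, y, m, n)) classes"

text \<open>By Cramer's rule, for determinant 8 the lattice points of the half-open parallelogram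
  are the integral ones among \<open>(i * g + j * h) / 8\<close> with \<open>i\<close> and
  \<open>j\<close> from 0 to 7. This makes completeness a finite check.\<close>

definition residues_complete :: "int \<times> int \<Rightarrow> int \<times> int \<Rightarrow> (int \<times> int) list \<Rightarrow> bool" where
  "residues_complete g h rs \<longleftrightarrow>
    fst g * snd h - snd g * fst h = 8 \<and>
    list_all (\<lambda>i. list_all (\<lambda>j.
      let x = i * fst g + j * fst h; y = i * snd g + j * snd h in
        x mod 8 = 0 \<longrightarrow> y mod 8 = 0 \<longrightarrow> List.member rs (x div 8, y div 8)) classes) classes"

text \<open>Together with \<open>residue_ok\<close> this supplies the six products of lengths that
  \<open>combined_length_le\<close> has to compare.\<close>

fun cone_ok :: "cost_vector \<times> cost_vector \<times> ((int \<times> int) \<times> nat list list) list \<Rightarrow> bool" where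
  "cone_ok ((x, y, m, n), (x', y', m', n'), rs) \<longleftrightarrow>
    compatible (x, y, m, n) (x, y, m, n) \<and> compatible (x, y, m, n) (x', y', m', n') \<and>
    compatible (x', y', m', n') (x', y', m', n') \<and>
    list_all (residue_ok (x, y, m, n) (x', y', m', n')) rs \<and>
    residues_complete (x, y) (x', y') (map fst rs)"

text \<open>The seventh highway points opposite to the first, so the six cones between successive
  highways fill a half-plane. The shorter inner \<open>zip\<close> drops the pair that would start
  at the seventh.\<close>

definition cones :: "(cost_vector \<times> cost_vector \<times> ((int \<times> int) \<times> nat list list) list) list" where
  "cones = zip (map fst highways) (zip (tl (map fst highways)) residues)"

lemma highways_ok: "list_all highway_ok highways"
  by code_simp

lemma cones_ok: "list_all cone_ok cones"
  by code_simp

lemma cone_bounds: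
  "map (\<lambda>((x, y, m, n), (x', y', m', n'), rs). ((x, y), (x', y'))) cones =
    [((2, 1), (2, 5)), ((2, 5), (0, 4)), ((0, 4), (-2, 3)), ((-2, 3), (-4, 2)),
     ((-4, 2), (-6, 1)), ((-6, 1), (-2, -1))]"
  by (simp add: cones_def highways_def residues_def)

section \<open>The upper bound\<close>

lemma mod_8_in_classes: "c mod 8 \<in> set classes"
  by (rule all_classes) code_simp

lemma reach_highway:
  assumes "((x, y, m, n), ps) \<in> set highways"
  shows "reach optimal_graph (pt u v) (pt (u + x) (v + y)) (cost m n)"
proof -
  define c where "c = (u - 2 * v) mod 8"
  obtain x' y' m' n' where w: "walk c (ps ! nat c) = (x', y', m', n')" by (metis prod_cases4)
  have "highway_ok ((x, y, m, n), ps)"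
    by (rule bspec[OF highways_ok[unfolded list_all_iff] assms])
  then have ok: "x' = x" "y' = y" "surd_nonneg (m - m') (n - n')"
    using mod_8_in_classes[of "u - 2 * v"] w by (auto simp: list_all_iff c_def)
  have "walk (u - 2 * v) (ps ! nat c) = (x, y, m', n')"
    using w ok by (simp add: c_def walk_mod)
  moreover have "cost m' n' \<le> cost m n"
    using surd_nonneg[OF ok(3)] by (simp add: cost_def algebra_simps)
  ultimately show ?thesis by (meson reach_walk reach_mono)
qed

lemma reach_highways:
  assumes "((x, y, m, n), ps) \<in> set highways"
  shows "reach optimal_graph (pt u v) (pt (u + int k * x) (v + int k * y)) (real k * cost m n)"
proof (induction k)
  case (Suc k)
  from reach_trans[OF Suc reach_highway[OF assms, of "u + int k * x" "v + int k * y"]]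
  show ?case by (simp add: algebra_simps)
qed (simp add: reach_refl)

text \<open>Expanding both squares, the hypotheses compare the coefficients one by one.\<close>

lemma combined_length_le:
  fixes l G H S r1 r2 g1 g2 h1 h2 :: real
  assumes "0 \<le> m" "0 \<le> n"
    and "l * l \<le> S * (r1 * r1 + r2 * r2)" "G * l \<le> S * (g1 * r1 + g2 * r2)"
    and "H * l \<le> S * (h1 * r1 + h2 * r2)" "G * G \<le> S * (g1 * g1 + g2 * g2)"
    and "G * H \<le> S * (g1 * h1 + g2 * h2)" "H * H \<le> S * (h1 * h1 + h2 * h2)"
  shows "(l + m * G + n * H)\<^sup>2 \<le> S * ((r1 + m * g1 + n * h1)\<^sup>2 + (r2 + m * g2 + n * h2)\<^sup>2)"
proof -
  have "(l + m * G + n * H)\<^sup>2 = l * l + 2 * (m * (G * l)) + 2 * (n * (H * l))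
      + m * m * (G * G) + 2 * (m * n * (G * H)) + n * n * (H * H)"
    by (simp add: power2_eq_square algebra_simps)
  also have "\<dots> \<le> S * (r1 * r1 + r2 * r2) + 2 * (m * (S * (g1 * r1 + g2 * r2)))
      + 2 * (n * (S * (h1 * r1 + h2 * r2))) + m * m * (S * (g1 * g1 + g2 * g2))
      + 2 * (m * n * (S * (g1 * h1 + g2 * h2))) + n * n * (S * (h1 * h1 + h2 * h2))"
    using assms by (intro add_mono mult_left_mono) auto
  also have "\<dots> = S * ((r1 + m * g1 + n * h1)\<^sup>2 + (r2 + m * g2 + n * h2)\<^sup>2)"
    by (simp add: power2_eq_square algebra_simps)
  finally show ?thesis .
qed

text \<open>In the basis \<open>g\<close>, \<open>h\<close> the point has coordinates
  \<open>i / 8\<close> and \<open>j / 8\<close> with the \<open>i\<close> and \<open>j\<close>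
  below. Their integer parts are the multiplicities and their fractional parts give the
  residue.\<close>

lemma cone_decomposition:
  fixes g1 g2 h1 h2 x y :: int
  assumes rs: "residues_complete (g1, g2) (h1, h2) rs"
    and "y * h1 \<le> x * h2" "g2 * x \<le> g1 * y"
  obtains r1 r2 m n where "(r1, r2) \<in> set rs"
    "x = r1 + int m * g1 + int n * h1" "y = r2 + int m * g2 + int n * h2"
proof -
  define i j where "i = x * h2 - y * h1" and "j = g1 * y - g2 * x"
  define r1 r2 where "r1 = x - (i div 8) * g1 - (j div 8) * h1"
    and "r2 = y - (i div 8) * g2 - (j div 8) * h2"
  have det: "g1 * h2 - g2 * h1 = 8" using rs by (simp add: residues_complete_def)
  have "i * g1 + j * h1 = x * (g1 * h2 - g2 * h1)" "i * g2 + j * h2 = y * (g1 * h2 - g2 * h1)"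
    unfolding i_def j_def by (simp_all add: algebra_simps)
  then have xy: "8 * x = i * g1 + j * h1" "8 * y = i * g2 + j * h2" unfolding det by simp_all
  have "8 * r1 = 8 * x - 8 * (i div 8) * g1 - 8 * (j div 8) * h1"
    "8 * r2 = 8 * y - 8 * (i div 8) * g2 - 8 * (j div 8) * h2"
    by (simp_all add: r1_def r2_def algebra_simps)
  moreover have "8 * (i div 8) = i - i mod 8" "8 * (j div 8) = j - j mod 8"
    by (simp_all only: minus_mod_eq_mult_div)
  ultimately have r: "(i mod 8) * g1 + (j mod 8) * h1 = 8 * r1"
    "(i mod 8) * g2 + (j mod 8) * h2 = 8 * r2"
    unfolding xy by (simp_all only: ring_distribs)
  have "(i mod 8, j mod 8) \<in> set classes \<times> set classes" by (simp add: mod_8_in_classes)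
  then have "(r1, r2) \<in> set rs"
    using rs r by (fastforce simp: residues_complete_def list_all_iff Let_def)
  \<comment> \<open>The two cone inequalities say that \<open>i\<close> and \<open>j\<close> are
    nonnegative, so \<open>nat\<close> loses nothing.\<close>
  moreover have "int (nat (i div 8)) = i div 8" "int (nat (j div 8)) = j div 8"
    using assms(2,3) by (simp_all add: i_def j_def)
  ultimately show thesis
    by (intro that[of r1 r2 "nat (i div 8)" "nat (j div 8)"]) (simp_all add: r1_def r2_def)
qed

abbreviation spanned :: "int \<Rightarrow> int \<Rightarrow> int \<Rightarrow> int \<Rightarrow> bool" where
  "spanned u v x y \<equiv> reach optimal_graph (pt u v) (pt (u + x) (v + y))
    ((1 + sqrt 2) * sqrt (of_int (x\<^sup>2 + y\<^sup>2)))"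

text \<open>The walk of the residue is followed by \<open>k\<close> copies of the first highway and
  \<open>l\<close> of the second; compatibility bounds the square of the total length.\<close>

lemma spanned_in_cone:
  assumes mem: "((g1, g2, gm, gn), (h1, h2, hm, hn), rs) \<in> set cones"
    and cone: "y * h1 \<le> x * h2" "g2 * x \<le> g1 * y"
  shows "spanned u v x y"
proof -
  have ok: "cone_ok ((g1, g2, gm, gn), (h1, h2, hm, hn), rs)"
    by (rule bspec[OF cones_ok[unfolded list_all_iff] mem])
  then have "residues_complete (g1, g2) (h1, h2) (map fst rs)" by simp
  from cone_decomposition[OF this cone] obtain r1 r2 k l where
    "(r1, r2) \<in> set (map fst rs)" and xy: "x = r1 + int k * g1 + int l * h1" "y = r2 + int k * g2 + int l * h2"
    by blast
  then obtain ps where ps: "((r1, r2), ps) \<in> set rs" by auto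
  define c where "c = (u - 2 * v) mod 8"
  obtain a b m n where w: "walk c (ps ! nat c) = (a, b, m, n)" by (metis prod_cases4)
  have "residue_ok (g1, g2, gm, gn) (h1, h2, hm, hn) ((r1, r2), ps)"
    using ok ps unfolding cone_ok.simps list_all_iff by blast
  then have res: "a = r1" "b = r2" "compatible (r1, r2, m, n) (r1, r2, m, n)"
    "compatible (g1, g2, gm, gn) (r1, r2, m, n)" "compatible (h1, h2, hm, hn) (r1, r2, m, n)"
    using mod_8_in_classes[of "u - 2 * v"] w by (auto simp: list_all_iff c_def simp del: compatible.simps)
  define L where "L = cost m n + real k * cost gm gn + real l * cost hm hn"
  have "(g1, g2, gm, gn) \<in> set (map fst highways)" "(h1, h2, hm, hn) \<in> set (tl (map fst highways))"
    using mem unfolding cones_def by (meson set_zip_leftD set_zip_rightD)+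
  then have "(g1, g2, gm, gn) \<in> set (map fst highways)" "(h1, h2, hm, hn) \<in> set (map fst highways)"
    by (metis list.sel(2) list.set_sel(2))+
  then obtain pg ph where hw: "((g1, g2, gm, gn), pg) \<in> set highways"
    "((h1, h2, hm, hn), ph) \<in> set highways"
    by auto
  have "walk (u - 2 * v) (ps ! nat c) = (r1, r2, m, n)"
    using w res by (simp add: c_def walk_mod)
  note reach_trans[OF reach_trans[OF reach_walk[OF this] reach_highways[OF hw(1), of _ _ k]]
      reach_highways[OF hw(2), of _ _ l]]
  then have R: "reach optimal_graph (pt u v) (pt (u + x) (v + y)) L"
    by (simp add: xy L_def add.assoc)
  have "0 \<le> real k" "0 \<le> real l" by simp_all
  \<comment> \<open>Here \<open>S\<close> is \<open>(1 + sqrt 2)\<^sup>2\<close>. The three products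
    involving the residue are supplied now; those of the two highways follow from
    \<open>cone_ok\<close>.\<close>
  note combined_length_le[OF this compatible[OF res(3), unfolded of_int_add of_int_mult]
      compatible[OF res(4), unfolded of_int_add of_int_mult]
      compatible[OF res(5), unfolded of_int_add of_int_mult]]
  moreover have "compatible (g1, g2, gm, gn) (g1, g2, gm, gn)"
    "compatible (g1, g2, gm, gn) (h1, h2, hm, hn)" "compatible (h1, h2, hm, hn) (h1, h2, hm, hn)"
    using ok unfolding cone_ok.simps by blast+
  note this[THEN compatible, unfolded of_int_add of_int_mult]
  ultimately have "L\<^sup>2 \<le> (1 + sqrt 2)\<^sup>2 * of_int (x\<^sup>2 + y\<^sup>2)"
    unfolding L_def by (simp add: xy)
  then have "L \<le> sqrt ((1 + sqrt 2)\<^sup>2 * of_int (x\<^sup>2 + y\<^sup>2))" by (rule real_le_rsqrt)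
  also have "\<dots> = (1 + sqrt 2) * sqrt (of_int (x\<^sup>2 + y\<^sup>2))"
    by (simp add: real_sqrt_mult)
  finally show ?thesis using R by (rule reach_mono[rotated])
qed

text \<open>The bounding line runs along the first highway \<open>(2, 1)\<close> and the last,
  \<open>(-2, -1)\<close>. Membership in a cone is the sign of two cross products, so the covering
  is a linear arithmetic fact.\<close>

lemma spanned_half_plane:
  assumes "x \<le> 2 * y"
  shows "spanned u v x y"
proof -
  have "\<exists>((g1, g2), (h1, h2)) \<in> set [((2, 1), (2, 5)), ((2, 5), (0, 4)), ((0, 4), (-2, 3)),
      ((-2, 3), (-4, 2)), ((-4, 2), (-6, 1)), ((-6, 1), (-2, -1::int))].
      y * h1 \<le> x * h2 \<and> g2 * x \<le> g1 * y"
    using assms by simp linarith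
  then show ?thesis
    unfolding cone_bounds[symmetric] by (auto intro: spanned_in_cone simp del: of_int_add)
qed

text \<open>The displacement or its negative lies in the half-plane; in the second case the walk is
  reversed.\<close>

lemma reach_lattice:
  "reach optimal_graph (pt x y) (pt x' y') ((1 + sqrt 2) * dist (pt x y) (pt x' y'))"
proof (cases "x' - x \<le> 2 * (y' - y)")
  case True
  from spanned_half_plane[OF this, of x y] show ?thesis by (simp add: dist_pt)
next
  case False
  then have "x - x' \<le> 2 * (y - y')" by simp
  from reach_sym[OF spanned_half_plane[OF this, of x' y']] show ?thesis
    by (simp add: dist_pt power2_commute)
qed

lemma dilation_optimal_graph: "dilation square_lattice optimal_graph \<le> ereal (1 + sqrt 2)"
  unfolding dilation_def
proof (intro SUP_least, clarify)
  fix p q assume "p \<in> square_lattice" "q \<in> square_lattice" "p \<noteq> q"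
  then have "graph_dist optimal_graph p q \<le> ereal ((1 + sqrt 2) * dist p q)"
    using reach_lattice by (auto simp: square_lattice_eq intro!: graph_dist_le_reach)
  then show "dilation_between optimal_graph p q \<le> ereal (1 + sqrt 2)"
    using \<open>p \<noteq> q\<close> unfolding dilation_between_def
    by (subst ereal_divide_le_pos) (auto simp: mult.commute)
qed

theorem mainTheorem1: "degree_dilation 3 square_lattice = ereal (1 + sqrt 2)"
proof (rule antisym)
  show "degree_dilation 3 square_lattice \<le> ereal (1 + sqrt 2)"
    unfolding degree_dilation_def
    using optimal_graph_geometric optimal_graph_plane optimal_graph_degree dilation_optimal_graph
    by (intro INF_lower2[of optimal_graph]) auto
  show "ereal (1 + sqrt 2) \<le> degree_dilation 3 square_lattice"
    unfolding degree_dilation_def using dilation_ge by (auto intro!: INF_greatest)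
qed

end
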